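(* Let $X=\{1,2\}$ with $1\prec2$ and write $\mathcal{SH}_{i,j}=\mathcal{SH}_{i,j}(E_2,E_1)$ for $i,j\ge0$, expanded in the PBW basis of Lyndon–Shirshov monomials of $\mathds{k}\langle E_1,E_2\rangle$. (a) Let $\mathcal{SH}_{i,j}^{[2]}$ be the sum of all terms of $\mathcal{SH}_{i,j}$ (with their coefficients) whose rightmost factor is not $E_1$. Then $\widehat{B}_{n,k}(E_1,E_2)=\mathcal{SH}^{[2]}_{k,n-k}$. (b) Let $\mathcal{SH}'_{i,j}$ be the sum of all terms of $\mathcal{SH}_{i,j}$ whose leftmost factor is not $E_2$. Then $\widehat{B}^*_{n,k}(E_2,E_1)=\mathcal{SH}'_{n-k,k}$.
   Context: Words on $X$ are ordered lexicographically ($\alpha\prec\beta$ iff $\alpha$ is a proper prefix of $\beta$ or $\alpha=\gamma a\eta,\beta=\gamma b\zeta$ with letters $a\prec b$). A nonempty word is Lyndon if it is a letter or strictly smaller than each rotation $\gamma\beta$ for $\alpha=\beta\gamma$, $\beta,\gamma$ nonempty. For non-letter Lyndon $\alpha$, $\alpha=\alpha_L\alpha_R$ with $\alpha_R$ the longest proper Lyndon suffix; $E_1=1$, $E_2=2$ are the generators and $E_\alpha=E_{\alpha_L}E_{\alpha_R}-E_{\alpha_R}E_{\alpha_L}$. The PBW basis consists of monomials $E_{\alpha_1}^{t_1}\cdots E_{\alpha_r}^{t_r}$ with $\alpha_1\succ\cdots\succ\alpha_r$ Lyndon, $t_i\ge1$; its "rightmost factor" is $E_{\alpha_r}$ and "leftmost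 factor" is $E_{\alpha_1}$. $\mathcal{SH}_{i,j}(y,x)$ is the sum of all words with exactly $i$ letters $y$ and $j$ letters $x$. Bell differential polynomials: for elements $x,y$ of an associative algebra, $\widehat{B}_0=1$, $\widehat{B}_{n+1}=[x,\widehat{B}_n]+y\widehat{B}_n$, and dually $\widehat{B}^*_0=1$, $\widehat{B}^*_{n+1}=[\widehat{B}^*_n,x]+\widehat{B}^*_ny$, where $[a,b]=ab-ba$. $\widehat{B}_{n,k}(x,y)$ (resp. $\widehat{B}^*_{n,k}(x,y)$) is the homogeneous component of $\widehat{B}_n$ (resp. $\widehat{B}^*_n$) of degree $k$ in $y$, i.e. $\widehat{B}_n=\sum_k\widehat{B}_{n,k}$ with $\widehat{B}_{n,k}(x,\lambda y)=\lambda^k\widehat{B}_{n,k}(x,y)$; set $\widehat{B}_{n,k}=0$ for $k=0<n$ or $k>n$. *)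

theory Defs
  imports Complex_Main "HOL-Library.Poly_Mapping" "HOL-Library.Sublist"
begin

datatype letter = L1 | L2

text \<open>
  Words under concatenation, written additively: the convolution product of
  \<^theory>\<open>HOL-Library.Poly_Mapping\<close> is indexed by an additive (here noncommutative) monoid.
\<close>

datatype word = Word (letters: "letter list")

instantiation word :: monoid_add
begin

definition "0 = Word []"
definition "u + v = Word (letters u @ letters v)"

instance
  by standard (simp_all add: zero_word_def plus_word_def)

end

type_synonym 'k free_algebra = "word \<Rightarrow>\<^sub>0 'k"

definition gen :: "letter \<Rightarrow> 'k::field free_algebra" where
  "gen a = Poly_Mapping.single (Word [a]) 1"

definition scale :: "'k::field \<Rightarrow> 'k free_algebra \<Rightarrow> 'k free_algebra" where
  "scale c p = Poly_Mapping.map ((*) c) p"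

lemma scale_conv_mult: "scale c p = Poly_Mapping.single 0 c * p"
  by (simp add: scale_def mult_map_scale_conv_mult)

interpretation free_algebra: vector_space scale
  by standard
    (simp_all add: scale_conv_mult algebra_simps single_add mult_single flip: mult.assoc)

definition word_less :: "letter list \<Rightarrow> letter list \<Rightarrow> bool" (infix \<open>\<prec>\<close> 50) where
  "u \<prec> v \<longleftrightarrow> (u, v) \<in> lexord {(L1, L2)}"

definition lyndon :: "letter list \<Rightarrow> bool" where
  "lyndon w \<longleftrightarrow> w \<noteq> [] \<and>
     (length w = 1 \<or> (\<forall>u v. w = u @ v \<and> u \<noteq> [] \<and> v \<noteq> [] \<longrightarrow> w \<prec> v @ u))"

definition right_factor :: "letter list \<Rightarrow> letter list" where
  "right_factor w = (ARG_MAX length v. strict_suffix v w \<and> lyndon v)"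

definition left_factor :: "letter list \<Rightarrow> letter list" where
  "left_factor w = take (length w - length (right_factor w)) w"

lemma right_factor:
  assumes "length w > 1"
  shows "strict_suffix (right_factor w) w" "lyndon (right_factor w)"
proof -
  have "w = butlast w @ [last w]" "butlast w \<noteq> []"
    using assms by (cases w rule: rev_cases; auto)+
  then have "strict_suffix [last w] w \<and> lyndon [last w]"
    unfolding lyndon_def strict_suffix_def suffix_def
    by (metis append_self_conv2 length_Cons list.size(3) not_Cons_self2 One_nat_def)
  moreover have "length v < length w" if "strict_suffix v w \<and> lyndon v" for v
    using that by (simp add: suffix_length_less)
  ultimately have "strict_suffix (right_factor w) w \<and> lyndon (right_factor w)"
    unfolding right_factor_def
    by (intro arg_max_natI[where P = "\<lambda>v. strict_suffix v w \<and> lyndon v" and f = length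
          and b = "length w"]) auto
  then show "strict_suffix (right_factor w) w" "lyndon (right_factor w)"
    by auto
qed

lemma left_factor_append_right_factor:
  assumes "length w > 1"
  shows "left_factor w @ right_factor w = w"
proof -
  obtain u where "w = u @ right_factor w"
    using right_factor(1)[OF assms] by (auto simp: strict_suffix_def suffix_def)
  then show ?thesis
    unfolding left_factor_def
    by (metis append_eq_conv_conj append_take_drop_id length_append add_diff_cancel_right')
qed

definition commutator :: "'a::ring \<Rightarrow> 'a \<Rightarrow> 'a" where
  "commutator a b = a * b - b * a"

text \<open>The value on words that are not Lyndon is irrelevant.\<close>

function E :: "letter list \<Rightarrow> 'k::field free_algebra" where
  "E w = (if \<not> lyndon w then 0
          else if length w = 1 then gen (hd w)
          else commutator (E (left_factor w)) (E (right_factor w)))"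
  by auto
termination
proof (relation "measure length")
  fix w :: "letter list"
  assume "\<not> \<not> lyndon w" "length w \<noteq> 1"
  then have w: "length w > 1"
    by (cases w) (auto simp: lyndon_def)
  then show "(right_factor w, w) \<in> measure length"
    using right_factor(1) by (simp add: suffix_length_less)
  have "length (right_factor w) > 0"
    using right_factor(2)[OF w] by (simp add: lyndon_def)
  then show "(left_factor w, w) \<in> measure length"
    using w unfolding left_factor_def in_measure length_take by linarith
qed auto

declare E.simps [simp del]

lemma E_letter: "E [a] = gen a"
  by (simp add: E.simps lyndon_def)

text \<open>
  A PBW monomial is represented by the list \<open>[(\<alpha>\<^sub>1, t\<^sub>1), \<dots>, (\<alpha>\<^sub>r, t\<^sub>r)]\<close>
  of its factors and exponents; the empty list stands for the unit monomial.
\<close>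

type_synonym monomial = "(letter list \<times> nat) list"

definition pbw_monomials :: "monomial set" where
  "pbw_monomials = {m. sorted_wrt (\<lambda>(u, _) (v, _). v \<prec> u) m \<and>
                       (\<forall>(u, t) \<in> set m. lyndon u \<and> t \<ge> 1)}"

definition monomial_value :: "monomial \<Rightarrow> 'k::field free_algebra" where
  "monomial_value m = prod_list (map (\<lambda>(u, t). E u ^ t) m)"

definition pbw_basis :: "'k::field free_algebra set" where
  "pbw_basis = monomial_value ` pbw_monomials"

text \<open>
  \<open>free_algebra.representation\<close> is constantly \<open>0\<close> unless \<open>pbw_basis\<close> is independent and spans
  the given element; that it is a basis is the PBW theorem, not an assumption.
\<close>

definition pbw_coeff :: "'k::field free_algebra \<Rightarrow> monomial \<Rightarrow> 'k" where
  "pbw_coeff p m = free_algebra.representation pbw_basis p (monomial_value m)"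

definition pbw_part :: "(monomial \<Rightarrow> bool) \<Rightarrow> 'k::field free_algebra \<Rightarrow> 'k free_algebra" where
  "pbw_part P p =
     (\<Sum>m \<in> {m \<in> pbw_monomials. pbw_coeff p m \<noteq> 0 \<and> P m}. scale (pbw_coeff p m) (monomial_value m))"

text \<open>The unit monomial has no factors, so it satisfies neither of the following.\<close>

definition rightmost_is :: "letter list \<Rightarrow> monomial \<Rightarrow> bool" where
  "rightmost_is u m \<longleftrightarrow> m \<noteq> [] \<and> fst (last m) = u"

definition leftmost_is :: "letter list \<Rightarrow> monomial \<Rightarrow> bool" where
  "leftmost_is u m \<longleftrightarrow> m \<noteq> [] \<and> fst (hd m) = u"

text \<open>Words in \<open>y\<close> and \<open>x\<close> are encoded over \<^typ>\<open>bool\<close>, with \<open>True\<close> standing for \<open>y\<close>.\<close>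

definition SH :: "nat \<Rightarrow> nat \<Rightarrow> 'a::ring_1 \<Rightarrow> 'a \<Rightarrow> 'a" where
  "SH i j y x = (\<Sum>w \<in> {w. count_list w True = i \<and> count_list w False = j}.
                   prod_list (map (\<lambda>b. if b then y else x) w))"

definition SH_E :: "nat \<Rightarrow> nat \<Rightarrow> 'k::field free_algebra" where
  "SH_E i j = SH i j (E [L2]) (E [L1])"

definition SH_2 :: "nat \<Rightarrow> nat \<Rightarrow> 'k::field free_algebra" where
  "SH_2 i j = pbw_part (\<lambda>m. \<not> rightmost_is [L1] m) (SH_E i j)"

definition SH' :: "nat \<Rightarrow> nat \<Rightarrow> 'k::field free_algebra" where
  "SH' i j = pbw_part (\<lambda>m. \<not> leftmost_is [L2] m) (SH_E i j)"

primrec bell :: "nat \<Rightarrow> 'a::ring_1 \<Rightarrow> 'a \<Rightarrow> 'a" where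
  "bell 0 x y = 1"
| "bell (Suc n) x y = commutator x (bell n x y) + y * bell n x y"

primrec dual_bell :: "nat \<Rightarrow> 'a::ring_1 \<Rightarrow> 'a \<Rightarrow> 'a" where
  "dual_bell 0 x y = 1"
| "dual_bell (Suc n) x y = commutator (dual_bell n x y) x + dual_bell n x y * y"

definition degree_component :: "letter \<Rightarrow> nat \<Rightarrow> 'k::field free_algebra \<Rightarrow> 'k free_algebra" where
  "degree_component a k p =
     (\<Sum>w \<in> {w \<in> Poly_Mapping.keys p. count_list (letters w) a = k}.
        Poly_Mapping.single w (Poly_Mapping.lookup p w))"

text \<open>
  The components of degree \<open>k\<close> in \<open>y\<close>, for \<open>x = E [a]\<close> and \<open>y = E [b]\<close> with
  \<open>a \<noteq> b\<close>; these are free generators, so the degree in \<open>y\<close> is the number of letters \<open>b\<close>.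
\<close>

definition bell_component :: "nat \<Rightarrow> nat \<Rightarrow> letter \<Rightarrow> letter \<Rightarrow> 'k::field free_algebra" where
  "bell_component n k a b = degree_component b k (bell n (E [a]) (E [b]))"

definition dual_bell_component :: "nat \<Rightarrow> nat \<Rightarrow> letter \<Rightarrow> letter \<Rightarrow> 'k::field free_algebra" where
  "dual_bell_component n k a b = degree_component b k (dual_bell n (E [a]) (E [b]))"

end

theory Submission
  imports Defs "HOL-Library.Multiset"
begin

text \<open>
  The bracketing \<open>E w\<close> of a Lyndon word is \<open>w\<close> plus larger words with the same letters, and by
  the Chen-Fox-Lyndon theorem every word is a unique nonincreasing product of Lyndon words. So the
  PBW monomials are unitriangular with respect to the words, hence a basis.

  Write \<open>x = E [L1]\<close>, \<open>y = E [L2]\<close>. Since left multiplication by \<open>x + y\<close> is the sum of the commuting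
  operators \<open>p \<mapsto> [x, p] + y p\<close> and \<open>p \<mapsto> p x\<close>, the power \<open>(x + y)^n\<close> is \<open>bell n x y\<close> modulo right
  multiples of \<open>x\<close>, and its component of degree \<open>k\<close> in \<open>y\<close> is the shuffle sum. Let \<open>T\<close> be the subalgebra
  generated by the iterates \<open>ad(x)^i y\<close>. It contains the Bell polynomials and all PBW monomials whose
  last factor is not \<open>x\<close>; the remaining monomials are right multiples of \<open>x\<close>. The products of the
  iterates have distinct leading words, none of which ends in \<open>L1\<close>, so \<open>T\<close> contains no nonzero
  right multiple of \<open>x\<close>, and the two decompositions agree. The argument does not depend on the
  characteristic. Part (b) is the mirror image, with \<open>p \<mapsto> [p, y]\<close> as the derivation.
\<close>

section \<open>Lyndon words\<close>

lemma word_less_Nil [simp]: "[] \<prec> v \<longleftrightarrow> v \<noteq> []" "\<not> u \<prec> []"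
  by (cases v) (auto simp: word_less_def)

lemma word_less_Cons [simp]: "a # u \<prec> b # v \<longleftrightarrow> a = L1 \<and> b = L2 \<or> a = b \<and> u \<prec> v"
  by (auto simp: word_less_def)

lemma word_less_append_same [simp]: "w @ u \<prec> w @ v \<longleftrightarrow> u \<prec> v"
  by (induction w) auto

lemma word_less_self_append [simp]: "u \<prec> u @ v \<longleftrightarrow> v \<noteq> []"
  using word_less_append_same[of u "[]" v] by simp

text \<open>Gives access to the theory of linear orders, in particular to the minimum
  \<open>word.Min\<close>, from which the lowest leading word of a sum is taken.\<close>

interpretation word: linorder "\<lambda>u v. u = v \<or> u \<prec> v" "(\<prec>)"
proof
  have irrefl: "\<not> u \<prec> u" for u
    by (induction u) auto
  have trans: "u \<prec> v \<Longrightarrow> v \<prec> w \<Longrightarrow> u \<prec> w" for u v w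
    unfolding word_less_def by (rule lexord_trans) (auto simp: trans_def)
  have total: "u \<prec> v \<or> u = v \<or> v \<prec> u" for u v
  proof (induction u arbitrary: v)
    case (Cons a u)
    then show ?case
      by (cases v; cases a; cases "hd v") auto
  qed auto
  fix u v w
  show "(u \<prec> v) = ((u = v \<or> u \<prec> v) \<and> \<not> (v = u \<or> v \<prec> u))"
    using irrefl trans by blast
  show "u = v \<or> u \<prec> v \<Longrightarrow> v = w \<or> v \<prec> w \<Longrightarrow> u = w \<or> u \<prec> w"
    using trans by blast
  show "u = v \<or> u \<prec> v \<Longrightarrow> v = u \<or> v \<prec> u \<Longrightarrow> u = v"
    using irrefl trans by blast
  show "(u = v \<or> u \<prec> v) \<or> (v = u \<or> v \<prec> u)"
    using total by blast
qed auto

text \<open>Without a prefix relation the first differing letter decides, and later letters have no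
  influence.\<close>

lemma word_less_append_mono:
  assumes "u \<prec> v" "\<not> prefix u v"
  shows "u @ x \<prec> v @ y"
  using assms
proof (induction u arbitrary: v)
  case (Cons a u)
  then show ?case
    by (cases v) auto
qed auto

text \<open>The length bound excludes that \<open>u\<close> is a proper prefix of
  \<open>v\<close>.\<close>

lemma word_less_append_mono_length:
  assumes "u \<prec> v" "length v \<le> length u"
  shows "u @ x \<prec> v @ y"
  using assms unfolding word_less_def by (rule lexord_sufI)

section \<open>Lyndon words and their suffixes\<close>

lemma lyndon_Nil [simp]: "\<not> lyndon []"
  by (simp add: lyndon_def)

lemma lyndon_letter [simp]: "lyndon [a]"
  by (simp add: lyndon_def)

text \<open>A suffix \<open>v\<close> below \<open>u @ v\<close> produces a rotation that is too
  small. If \<open>v\<close> is not a prefix, the first differing letter gives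
  \<open>v @ u \<prec> u @ v\<close>. If \<open>u @ v = v @ u'\<close>, the rotation
  \<open>v @ u\<close> forces \<open>u' \<prec> u\<close>, and then \<open>u' @ v\<close> is a
  smaller rotation.\<close>

lemma lyndon_less_suffix:
  assumes "lyndon (u @ v)" "u \<noteq> []" "v \<noteq> []"
  shows "u @ v \<prec> v"
proof (rule ccontr)
  assume "\<not> u @ v \<prec> v"
  then have less: "v \<prec> u @ v"
    using assms(2) word.linear[of v "u @ v"] by simp
  have rotation: "u @ v \<prec> y @ x" if "u @ v = x @ y" "x \<noteq> []" "y \<noteq> []" for x y
  proof -
    have "length (u @ v) \<noteq> 1"
      using that by (cases x; cases y) auto
    then show ?thesis
      using assms(1) that unfolding lyndon_def by blast
  qed
  show False
  proof (cases "prefix v (u @ v)")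
    case True
    then obtain u' where u': "u @ v = v @ u'"
      by (auto simp: prefix_def)
    then have len: "length u' = length u"
      using arg_cong[OF u', of length] unfolding length_append by linarith
    moreover have "u' \<prec> u"
      using rotation[OF refl assms(2,3)] u'
      by (metis word_less_append_same)
    ultimately have "u' @ v \<prec> u @ v"
      by (intro word_less_append_mono_length) auto
    moreover have "u @ v \<prec> u' @ v"
      using rotation[OF u'] assms(2,3) len u' by (cases "u' = []") auto
    ultimately show False
      by (metis word.less_asym)
  next
    case False
    then have "v @ u \<prec> (u @ v) @ []"
      using less by (intro word_less_append_mono)
    then show False
      using rotation[OF refl assms(2,3)] by (metis append_Nil2 word.less_asym)
  qed
qed

text \<open>Converse of \<open>lyndon_less_suffix\<close>: the suffix \<open>v\<close> is a proper
  prefix of the rotation \<open>v @ u\<close>, hence below it.\<close>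

lemma lyndonI:
  assumes "w \<noteq> []" "\<And>u v. w = u @ v \<Longrightarrow> u \<noteq> [] \<Longrightarrow> v \<noteq> [] \<Longrightarrow> w \<prec> v"
  shows "lyndon w"
  unfolding lyndon_def using assms
  by (metis word.less_trans word_less_self_append)

text \<open>By \<open>lyndonI\<close> only suffixes matter. A proper suffix is either
  \<open>z @ v\<close> with \<open>z\<close> a suffix of \<open>u\<close>, where
  \<open>u \<prec> z\<close> decides unless \<open>z\<close> is empty, or a suffix of
  \<open>v\<close>, which is at least \<open>v\<close> and so above \<open>u @ v\<close>.\<close>

lemma lyndon_append:
  assumes "lyndon u" "lyndon v" "u \<prec> v"
  shows "lyndon (u @ v)"
proof (rule lyndonI)
  have less_v: "u @ v \<prec> v"
  proof (cases "prefix u v")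
    case True
    then obtain v' where v': "v = u @ v'"
      by (auto simp: prefix_def)
    \<comment> \<open>Prepending \<open>u\<close> on both sides turns this into
      \<open>u @ v \<prec> v\<close>.\<close>
    then have "v \<prec> v'"
      using assms lyndon_less_suffix[of u v'] by (cases "u = []"; cases "v' = []") auto
    then show ?thesis
      using v' by (metis word_less_append_same)
  next
    case False
    then show ?thesis
      using word_less_append_mono[OF assms(3), of v "[]"] by simp
  qed
  fix x y assume xy: "u @ v = x @ y" "x \<noteq> []" "y \<noteq> []"
  then consider z where "u = x @ z" "y = z @ v" | z where "x = u @ z" "v = z @ y"
    by (auto simp: append_eq_append_conv2)
  then show "u @ v \<prec> y"
  proof cases
    case 1
    show ?thesis
    proof (cases "z = []")
      case False
      then have "u \<prec> z"
        using assms(1) 1 xy lyndon_less_suffix by blast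
      then show ?thesis
        using 1 word_less_append_mono_length[of u z v v] by simp
    qed (use 1 less_v in simp)
  next
    case 2
    show ?thesis
    proof (cases "z = []")
      case False
      then have "v \<prec> y"
        using assms(2) 2 xy lyndon_less_suffix by blast
      with less_v show ?thesis
        by (rule word.less_trans)
    qed (use 2 less_v in simp)
  qed
qed (use assms in auto)

lemma L1_le: "u \<noteq> [] \<Longrightarrow> \<not> u \<prec> [L1]"
  by (cases u) auto

text \<open>The last letter is a proper suffix, so \<open>w \<prec> [last w]\<close>. No nonempty
  word is below \<open>[L1]\<close>, and the words below \<open>[L2]\<close> that are nonempty begin
  with \<open>L1\<close>.\<close>

lemma lyndon_ends:
  assumes "lyndon w" "length w > 1"
  shows "hd w = L1" "last w = L2"
proof -
  have "w = butlast w @ [last w]" "butlast w \<noteq> []"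
    using assms by (cases w rule: rev_cases; auto)+
  then have less: "w \<prec> [last w]"
    using assms(1) lyndon_less_suffix[of "butlast w" "[last w]"] by auto
  then show "last w = L2"
    using assms L1_le[of w] by (cases "last w"; cases w) auto
  with less show "hd w = L1"
    using assms(1) by (cases w; cases "hd w") auto
qed

section \<open>The Chen-Fox-Lyndon factorization\<close>

lemma lyndon_factorization_Cons:
  assumes "lyndon u" "\<forall>v \<in> set l. lyndon v" "sorted_wrt (\<lambda>u v. \<not> u \<prec> v) l"
  shows "\<exists>l'. (\<forall>v \<in> set l'. lyndon v) \<and> sorted_wrt (\<lambda>u v. \<not> u \<prec> v) l' \<and> concat l' = u @ concat l"
  using assms
proof (induction l arbitrary: u)
  case Nil
  then show ?case
    by (intro exI[of _ "[u]"]) auto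
next
  case (Cons v l)
  show ?case
  \<comment> \<open>Two factors in the wrong order merge into one Lyndon word, which is again put in
    front of a shorter list.\<close>
  proof (cases "u \<prec> v")
    case True
    then have "lyndon (u @ v)"
      using Cons.prems by (auto intro: lyndon_append)
    then show ?thesis
      using Cons.IH[of "u @ v"] Cons.prems by auto
  next
    case False
    then have "\<not> u \<prec> w" if "w \<in> set l" for w
      using that Cons.prems(3) by (auto dest: word.less_le_trans simp: word.not_less)
    then show ?thesis
      using False Cons.prems by (intro exI[of _ "u # v # l"]) auto
  qed
qed

lemma lyndon_factorization_exists:
  "\<exists>l. (\<forall>v \<in> set l. lyndon v) \<and> sorted_wrt (\<lambda>u v. \<not> u \<prec> v) l \<and> concat l = w"
proof (induction w)
  case (Cons a w)
  then show ?case
    using lyndon_factorization_Cons[of "[a]"] by fastforce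
qed (intro exI[of _ "[]"], auto)

text \<open>\<open>s\<close> is the part of \<open>c\<close> inside the last factor that
  \<open>c\<close> reaches. In the uniqueness argument a Lyndon prefix that is too long is compared
  with this suffix.\<close>

lemma prefix_concat_last:
  assumes "prefix c (concat l)" "c \<noteq> []"
  shows "\<exists>s x. c = x @ s \<and> s \<noteq> [] \<and> (\<exists>v \<in> set l. prefix s v)"
  using assms
proof (induction l arbitrary: c)
  case (Cons v l)
  show ?case
  proof (cases "prefix c v")
    case True
    then show ?thesis
      using Cons.prems by (intro exI[of _ c] exI[of _ "[]"]) auto
  next
    case False
    then obtain c' where c': "c = v @ c'" "prefix c' (concat l)"
      using Cons.prems(1) by (auto simp: prefix_append)
    moreover have "c' \<noteq> []"
      using False c' by auto
    ultimately obtain s x where "c' = x @ s" "s \<noteq> []" "\<exists>v \<in> set l. prefix s v"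
      using Cons.IH by blast
    then show ?thesis
      using c' by (intro exI[of _ s] exI[of _ "v @ x"]) auto
  qed
qed auto

text \<open>The first factor is the longest Lyndon prefix.\<close>

lemma lyndon_factorization_first:
  assumes "\<forall>v \<in> set (u # l). lyndon v" "sorted_wrt (\<lambda>u v. \<not> u \<prec> v) (u # l)"
    and "lyndon p" "prefix p (u @ concat l)"
  shows "length p \<le> length u"
proof (rule ccontr)
  assume "\<not> length p \<le> length u"
  then obtain c where c: "p = u @ c" "c \<noteq> []" "prefix c (concat l)"
    using assms(4) by (auto simp: prefix_append dest: prefix_length_le)
  then obtain s x v where s: "c = x @ s" "s \<noteq> []" "v \<in> set l" "prefix s v"
    using prefix_concat_last by blast
  have "u \<noteq> []"
    using assms(1) by auto
  then have "p \<prec> s"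
    using assms(3) c s lyndon_less_suffix[of "u @ x" s] by auto
  moreover have "s = v \<or> s \<prec> v"
    using s(4) by (auto simp: prefix_def)
  moreover have "\<not> u \<prec> v"
    using assms(2) s(3) by auto
  moreover have "u \<prec> p"
    using c by simp
  \<comment> \<open>The chain \<open>u \<prec> p \<prec> s\<close>, with \<open>s\<close> at most
    \<open>v\<close> and \<open>v\<close> at most \<open>u\<close>, is circular.\<close>
  ultimately show False
    by (metis word.less_trans)
qed

text \<open>Either first factor is a Lyndon prefix of the common word, so by
  \<open>lyndon_factorization_first\<close> neither is longer than the other.\<close>

lemma lyndon_factorization_unique:
  assumes "\<forall>v \<in> set l. lyndon v" "sorted_wrt (\<lambda>u v. \<not> u \<prec> v) l"
    and "\<forall>v \<in> set l'. lyndon v" "sorted_wrt (\<lambda>u v. \<not> u \<prec> v) l'"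
    and "concat l = concat l'"
  shows "l = l'"
  using assms
proof (induction l arbitrary: l')
  case Nil
  then show ?case
    by (cases l') auto
next
  case (Cons u l)
  then obtain v m where l': "l' = v # m"
    by (cases l') auto
  have eq: "u @ concat l = v @ concat m"
    using Cons.prems(5) l' by simp
  have "prefix v (u @ concat l)" "prefix u (v @ concat m)"
    using eq by (simp, simp flip: eq)
  then have "length v \<le> length u" "length u \<le> length v"
    using Cons.prems(1-4) lyndon_factorization_first[of u l v] lyndon_factorization_first[of v m u]
    unfolding l' by auto
  then have "u = v" "concat l = concat m"
    using Cons.prems(5) l' by auto
  moreover have "l = m"
    using Cons.prems l' \<open>concat l = concat m\<close> by (intro Cons.IH) simp_all
  ultimately show ?case
    using l' by simp
qed

section \<open>The standard factorization\<close>

lemma left_factor_ne_Nil: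
  assumes "length w > 1"
  shows "left_factor w \<noteq> []"
proof
  assume "left_factor w = []"
  then have "right_factor w = w"
    using left_factor_append_right_factor[OF assms] by simp
  then show False
    using right_factor(1)[OF assms] by simp
qed

text \<open>Let \<open>r\<close> be the last Lyndon factor of a proper suffix \<open>s\<close> of
  the left factor \<open>?u\<close>. If \<open>r\<close> were below the right factor
  \<open>?v\<close>, then \<open>r @ ?v\<close> would be a longer proper Lyndon suffix of
  \<open>w\<close>. Hence \<open>?u \<prec> w \<prec> ?v\<close>, with \<open>?v\<close> at most
  \<open>r\<close> and \<open>r\<close> at most \<open>s\<close>.\<close>

lemma lyndon_left_factor:
  assumes "lyndon w" "length w > 1"
  shows "lyndon (left_factor w)"
proof (rule lyndonI)
  let ?u = "left_factor w" and ?v = "right_factor w"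
  have uv: "?u @ ?v = w" and v: "lyndon ?v"
    using assms left_factor_append_right_factor right_factor by blast+
  show "?u \<noteq> []"
    using assms(2) by (rule left_factor_ne_Nil)
  have longest: "length x \<le> length ?v" if "lyndon x" "strict_suffix x w" for x
    unfolding right_factor_def
    by (rule arg_max_nat_le[where b = "length w"]) (use that in \<open>auto simp: suffix_length_less\<close>)
  fix t s assume ts: "?u = t @ s" "t \<noteq> []" "s \<noteq> []"
  obtain l where l: "\<forall>v \<in> set l. lyndon v" "sorted_wrt (\<lambda>u v. \<not> u \<prec> v) l" "concat l = s"
    using lyndon_factorization_exists by blast
  with ts obtain l1 r where l1: "l = l1 @ [r]"
    by (cases l rule: rev_cases) auto
  then have r: "lyndon r" "s = concat l1 @ r"
    using l by auto
  have "\<not> r \<prec> ?v"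
  proof
    assume "r \<prec> ?v"
    then have "lyndon (r @ ?v)"
      using r v by (intro lyndon_append)
    moreover have "strict_suffix (r @ ?v) w"
    proof -
      have eq: "(t @ concat l1) @ r @ ?v = w"
        using uv ts r by (metis append.assoc)
      have "strict_suffix (r @ ?v) ((t @ concat l1) @ r @ ?v)"
        using ts(2) suffixI[OF append_assoc[symmetric]] by (simp add: strict_suffix_def suffix_append)
      then show ?thesis
        unfolding eq .
    qed
    ultimately show False
      using longest[of "r @ ?v"] r(1) by simp
  qed
  moreover have "\<not> s \<prec> r"
  proof (cases l1)
    case Nil
    then show ?thesis
      using r by simp
  next
    case (Cons a l2)
    \<comment> \<open>\<open>a\<close> is the first factor of \<open>s\<close>: it is at least the
      last factor \<open>r\<close>, and a prefix of \<open>s\<close>.\<close>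
    then have "\<not> a \<prec> r" "s = a \<or> a \<prec> s"
      using l l1 by auto
    then show ?thesis
      by (metis word.less_trans word.neqE)
  qed
  moreover have "w \<prec> ?v"
    using assms(1) uv v lyndon_less_suffix[of ?u ?v] \<open>?u \<noteq> []\<close> by (metis lyndon_Nil)
  moreover have "?u \<prec> w"
    using uv v word_less_self_append[of ?u ?v] by (metis lyndon_Nil)
  ultimately show "?u \<prec> s"
    by (metis word.less_trans word.neqE)
qed

section \<open>Leading words\<close>

lemma keys_minus_subset: "Poly_Mapping.keys (p - q) \<subseteq> Poly_Mapping.keys p \<union> Poly_Mapping.keys q"
  for p q :: "'a \<Rightarrow>\<^sub>0 'b::ab_group_add"
  by (auto simp: in_keys_iff lookup_minus)

lemma lookup_scale: "Poly_Mapping.lookup (scale c p) w = c * Poly_Mapping.lookup p w"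
  unfolding scale_def by transfer (simp add: when_def)

lemma scale_mult_left: "scale c p * q = scale c (p * q)"
  by (simp add: scale_conv_mult mult.assoc)

lemma expansion_in_words:
  "p = (\<Sum>w \<in> Poly_Mapping.keys p. scale (Poly_Mapping.lookup p w) (Poly_Mapping.single w 1))"
  by (rule poly_mapping_eqI) (simp add: lookup_sum lookup_scale lookup_single when_def in_keys_iff
      if_distrib[of "(*) _"] cong: if_cong)

text \<open>Scalars sit on the empty word, the neutral index, so they commute with every word
  although words do not commute with each other.\<close>

lemma scale_mult_right:
  fixes p :: "'k::field free_algebra"
  shows "p * scale c q = scale c (p * q)"
proof -
  have "p * Poly_Mapping.single 0 c = Poly_Mapping.single 0 c * p"
    by (subst (1 2) expansion_in_words)
      (simp add: sum_distrib_left sum_distrib_right scale_conv_mult mult_single mult.commute)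
  then show ?thesis
    by (simp add: scale_conv_mult flip: mult.assoc)
qed

text \<open>Fixing the multiset of letters gives all these words one length, so that comparisons
  survive appending, and makes every element with a leading word homogeneous in each letter.\<close>

definition higher_words :: "letter list \<Rightarrow> word set" where
  "higher_words w = {v. mset (letters v) = mset w \<and> w \<prec> letters v}"

definition leads :: "'k::field free_algebra \<Rightarrow> letter list \<Rightarrow> bool" where
  "leads p w \<longleftrightarrow> Poly_Mapping.keys (p - Poly_Mapping.single (Word w) 1) \<subseteq> higher_words w"

lemma leads_lookup:
  assumes "leads p w"
  shows "Poly_Mapping.lookup p (Word w) = 1"
    "Poly_Mapping.lookup p (Word v) \<noteq> 0 \<Longrightarrow> v = w \<or> mset v = mset w \<and> w \<prec> v"
proof -
  have "Word w \<notin> Poly_Mapping.keys (p - Poly_Mapping.single (Word w) 1)"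
    using assms by (auto simp: leads_def higher_words_def dest!: subsetD)
  then show "Poly_Mapping.lookup p (Word w) = 1"
    by (simp add: in_keys_iff lookup_minus)
  assume "Poly_Mapping.lookup p (Word v) \<noteq> 0"
  then have "v = w \<or> Word v \<in> Poly_Mapping.keys (p - Poly_Mapping.single (Word w) 1)"
    by (auto simp: in_keys_iff lookup_minus lookup_single when_def)
  then show "v = w \<or> mset v = mset w \<and> w \<prec> v"
    using assms by (auto simp: leads_def higher_words_def dest!: subsetD)
qed

lemma leads_unique:
  assumes "leads p u" "leads p v"
  shows "u = v"
  using leads_lookup[OF assms(1)] leads_lookup[OF assms(2)]
  by (metis word.less_asym zero_neq_one)

lemma leads_single: "leads (Poly_Mapping.single (Word w) 1) w"
  by (simp add: leads_def)

lemma leads_one: "leads 1 []"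
  using leads_single[of "[]"] by (simp flip: zero_word_def)

text \<open>The error splits as \<open>u * (q - v) + (p - u) * q\<close>. In the second part a word
  \<open>x\<close> above \<open>u\<close> of the same length decides the comparison, whatever
  follows.\<close>

lemma leads_mult:
  assumes "leads p u" "leads q v"
  shows "leads (p * q) (u @ v)"
proof -
  let ?p = "p - Poly_Mapping.single (Word u) 1" and ?q = "q - Poly_Mapping.single (Word v) 1"
  have "p * q - Poly_Mapping.single (Word (u @ v)) 1 =
      Poly_Mapping.single (Word u) 1 * ?q + ?p * q"
    by (simp add: algebra_simps mult_single plus_word_def)
  moreover have "Poly_Mapping.keys (Poly_Mapping.single (Word u) 1 * ?q) \<subseteq> higher_words (u @ v)"
    using keys_mult[of "Poly_Mapping.single (Word u) 1" ?q] assms(2)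
    by (fastforce simp: leads_def higher_words_def plus_word_def)
  moreover have "Poly_Mapping.keys (?p * q) \<subseteq> higher_words (u @ v)"
  proof
    fix w assume "w \<in> Poly_Mapping.keys (?p * q)"
    then obtain x y where w: "w = Word (x @ y)" and x: "Word x \<in> Poly_Mapping.keys ?p"
      and y: "Word y \<in> Poly_Mapping.keys q"
      using keys_mult[of ?p q] by (force simp: plus_word_def)
    have x': "mset x = mset u" "u \<prec> x"
      using x assms(1) by (auto simp: leads_def higher_words_def dest!: subsetD)
    then have "u @ v \<prec> x @ y"
      by (intro word_less_append_mono_length) (auto dest: mset_eq_length)
    then show "w \<in> higher_words (u @ v)"
      using w x' y leads_lookup(2)[OF assms(2)] by (auto simp: higher_words_def in_keys_iff)
  qed
  ultimately show ?thesis
    unfolding leads_def using Un_least[THEN subset_trans[OF keys_add]] by simp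
qed

text \<open>All words of \<open>q * p\<close> are at least \<open>v @ u\<close>, so the second
  product changes only words above \<open>u @ v\<close>.\<close>

lemma leads_commutator:
  assumes "leads p u" "leads q v" "u @ v \<prec> v @ u"
  shows "leads (commutator p q) (u @ v)"
proof -
  have "higher_words (v @ u) \<subseteq> higher_words (u @ v)" "Word (v @ u) \<in> higher_words (u @ v)"
    using assms(3) by (auto simp: higher_words_def intro: word.less_trans)
  moreover have "Poly_Mapping.keys (q * p) \<subseteq> insert (Word (v @ u)) (higher_words (v @ u))"
    using leads_lookup(2)[OF leads_mult[OF assms(2,1)]]
    by (auto simp: in_keys_iff higher_words_def) (metis word.exhaust_sel)+
  ultimately have "Poly_Mapping.keys (q * p) \<subseteq> higher_words (u @ v)"
    by blast
  moreover have eq: "commutator p q - Poly_Mapping.single (Word (u @ v)) 1 =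
      (p * q - Poly_Mapping.single (Word (u @ v)) 1) - q * p"
    by (simp add: commutator_def)
  ultimately show ?thesis
    using leads_mult[OF assms(1,2)] Un_least[THEN subset_trans[OF keys_minus_subset]]
    unfolding leads_def eq by simp
qed

lemma leads_prod_list:
  assumes "\<And>i. i \<in> set is \<Longrightarrow> leads (f i) (w i)"
  shows "leads (prod_list (map f is)) (concat (map w is))"
  using assms by (induction "is") (auto intro: leads_one leads_mult)

section \<open>Families with distinct leading words\<close>

definition triangular :: "'k::field free_algebra set \<Rightarrow> bool" where
  "triangular B \<longleftrightarrow> (\<forall>b \<in> B. \<exists>w. leads b w) \<and>
     (\<forall>b \<in> B. \<forall>b' \<in> B. \<forall>w. leads b w \<longrightarrow> leads b' w \<longrightarrow> b = b')"

text \<open>Among the elements with nonzero coefficient take the one whose leading word is lowest.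
  The others have only words at or above their own leading words, so nothing cancels it.\<close>

lemma triangular_sum:
  assumes "triangular B" "finite t" "t \<subseteq> B" "b \<in> t" "c b \<noteq> 0"
  shows "\<exists>b \<in> B. \<exists>w. leads b w \<and> Poly_Mapping.lookup (\<Sum>b \<in> t. scale (c b) b) (Word w) \<noteq> 0"
proof -
  define l where "l = (\<lambda>b::'a free_algebra. SOME w. leads b w)"
  have l: "leads b (l b)" if "b \<in> t" for b
    unfolding l_def using that assms(1,3) by (auto simp: triangular_def intro: someI)
  let ?t = "{b \<in> t. c b \<noteq> 0}"
  obtain m where m: "m \<in> ?t" "\<And>b. b \<in> ?t \<Longrightarrow> \<not> l b \<prec> l m"
  proof -
    have "finite (l ` ?t)" "l ` ?t \<noteq> {}"
      using assms by auto
    then have "word.Min (l ` ?t) \<in> l ` ?t"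
      by (rule word.Min_in)
    then obtain m where m: "word.Min (l ` ?t) = l m" "m \<in> ?t"
      by (rule imageE)
    show thesis
    proof (rule that[OF m(2)])
      fix b assume "b \<in> ?t"
      then have "word.Min (l ` ?t) = l b \<or> word.Min (l ` ?t) \<prec> l b"
        using \<open>finite (l ` ?t)\<close> by (intro word.Min_le) simp_all
      then show "\<not> l b \<prec> l m"
        unfolding m(1) by (rule word.leD)
    qed
  qed
  have "Poly_Mapping.lookup b (Word (l m)) = 0" if b: "b \<in> ?t" "b \<noteq> m" for b
  proof (rule ccontr)
    assume "Poly_Mapping.lookup b (Word (l m)) \<noteq> 0"
    then have eq: "l b = l m"
      using leads_lookup(2)[OF l[of b], of "l m"] b m(2)[of b] by auto
    have "leads b (l m)" "leads m (l m)" "b \<in> B" "m \<in> B"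
      using b m(1) l[of b] l[of m] assms(3) eq by auto
    then show False
      using assms(1) b(2) unfolding triangular_def by blast
  qed
  then have "(\<Sum>b \<in> t. c b * Poly_Mapping.lookup b (Word (l m))) =
      (\<Sum>b \<in> t. if b = m then c m else 0)"
    using m(1) l leads_lookup(1) by (intro sum.cong) auto
  then have "Poly_Mapping.lookup (\<Sum>b \<in> t. scale (c b) b) (Word (l m)) = c m"
    using m(1) assms(2) by (simp add: lookup_sum lookup_scale)
  then have "Poly_Mapping.lookup (\<Sum>b \<in> t. scale (c b) b) (Word (l m)) \<noteq> 0"
    using m(1) by simp
  moreover have "m \<in> B" "leads m (l m)"
    using m(1) l assms(3) by auto
  ultimately show ?thesis
    by (intro bexI exI conjI)
qed

lemma triangular_independent:
  assumes "triangular B"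
  shows "free_algebra.independent B"
proof
  assume "free_algebra.dependent B"
  then obtain t c b where t: "finite t" "t \<subseteq> B" "b \<in> t" "c b \<noteq> 0" "(\<Sum>b \<in> t. scale (c b) b) = 0"
    unfolding free_algebra.dependent_explicit by blast
  show False
    using triangular_sum[of B t b c, OF assms t(1-4)] unfolding t(5) by simp
qed

text \<open>Serves as a vanishing test: an element of the span is 0 once none of the leading words
  of \<open>B\<close> occurs in it.\<close>

lemma triangular_span_nonzero:
  assumes "triangular B" "p \<in> free_algebra.span B" "p \<noteq> 0"
  shows "\<exists>b \<in> B. \<exists>w. leads b w \<and> Poly_Mapping.lookup p (Word w) \<noteq> 0"
proof -
  obtain t c where t: "finite t" "t \<subseteq> B" "p = (\<Sum>b \<in> t. scale (c b) b)"
    using assms(2) by (auto simp: free_algebra.span_explicit)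
  then obtain b where "b \<in> t" "c b \<noteq> 0"
    using assms(3) by (force intro: sum.neutral)
  from triangular_sum[of B t b c, OF assms(1) t(1,2) this] show ?thesis
    unfolding t(3) .
qed

text \<open>Downward induction among the finitely many words of one length: removing
  \<open>w\<close> from an element led by \<open>w\<close> leaves only larger words.\<close>

lemma single_in_span:
  assumes "\<And>w. \<exists>b \<in> B. leads b w"
  shows "Poly_Mapping.single (Word w) 1 \<in> free_algebra.span B"
proof (induction "card {v. length v = length w \<and> w \<prec> v}" arbitrary: w rule: less_induct)
  case less
  obtain b where b: "b \<in> B" "leads b w"
    using assms by blast
  let ?q = "b - Poly_Mapping.single (Word w) 1"
  have single: "Poly_Mapping.single v 1 \<in> free_algebra.span B" if "v \<in> Poly_Mapping.keys ?q" for v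
  proof -
    have v: "length (letters v) = length w" "w \<prec> letters v"
      using that b(2) by (auto simp: leads_def higher_words_def dest!: subsetD dest: mset_eq_length)
    have "finite (UNIV :: letter set)"
      by (rule finite_subset[of _ "{L1, L2}"]) (use letter.exhaust in auto)
    then have "finite {u :: letter list. length u = length w}"
      using finite_lists_length_eq[of "UNIV :: letter set" "length w"] by simp
    then have "card {u. length u = length (letters v) \<and> letters v \<prec> u} < card {u. length u = length w \<and> w \<prec> u}"
      using v by (intro psubset_card_mono) (auto intro: word.less_trans)
    from less[OF this] show ?thesis
      by simp
  qed
  have "?q \<in> free_algebra.span B"
    by (subst expansion_in_words) (intro free_algebra.span_sum free_algebra.span_scale single)
  then have "b - ?q \<in> free_algebra.span B"
    by (rule free_algebra.span_diff[OF free_algebra.span_base[OF b(1)]])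
  then show ?case
    by simp
qed

lemma span_eq_UNIV:
  assumes "\<And>w. \<exists>b \<in> B. leads b w"
  shows "free_algebra.span B = UNIV"
proof -
  have "p \<in> free_algebra.span B" for p
    using single_in_span[OF assms, of "letters _"]
    by (subst expansion_in_words) (auto intro: free_algebra.span_sum free_algebra.span_scale)
  then show ?thesis
    by blast
qed

section \<open>The PBW basis\<close>

text \<open>\<open>?v @ ?u\<close> is a rotation of the Lyndon word \<open>?u @ ?v\<close> and hence
  larger, which is what \<open>leads_commutator\<close> requires.\<close>

lemma leads_E: "lyndon w \<Longrightarrow> leads (E w :: 'k::field free_algebra) w"
proof (induction w rule: measure_induct_rule[of length])
  case (less w)
  show ?case
  proof (cases "length w = 1")
    case True
    then obtain a where "w = [a]"
      by (auto simp: length_Suc_conv)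
    then show ?thesis
      using leads_single[of "[a]"] by (simp add: E_letter gen_def)
  next
    case False
    moreover have "w \<noteq> []"
      using less.prems by auto
    ultimately have w: "length w > 1"
      by (cases w) auto
    let ?u = "left_factor w" and ?v = "right_factor w"
    have uv: "?u @ ?v = w" and v: "lyndon ?v" and u: "lyndon ?u"
      using w less.prems left_factor_append_right_factor right_factor lyndon_left_factor by blast+
    have ne: "?u \<noteq> []" "?v \<noteq> []"
      using u v by auto
    have "length (?u @ ?v) = length w"
      unfolding uv ..
    then have len: "length ?u < length w" "length ?v < length w"
      using ne by (simp_all flip: length_greater_0_conv)
    have "?u @ ?v \<prec> ?v @ ?u"
      using less.prems False ne uv unfolding lyndon_def by metis
    then have "leads (commutator (E ?u) (E ?v :: 'k free_algebra)) (?u @ ?v)"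
      using less.IH u v len by (intro leads_commutator) auto
    moreover have "E w = commutator (E ?u) (E ?v :: 'k free_algebra)"
      using False less.prems by (subst E.simps) simp
    ultimately show ?thesis
      using uv by simp
  qed
qed

text \<open>With exponents written out, a PBW monomial becomes a nonincreasing list of Lyndon words,
  that is, a Chen-Fox-Lyndon factorization.\<close>

definition factors :: "monomial \<Rightarrow> letter list list" where
  "factors m = concat (map (\<lambda>(u, t). replicate t u) m)"

lemma factors_simps [simp]:
  "factors [] = []" "factors ((u, t) # m) = replicate t u @ factors m"
  by (simp_all add: factors_def)

lemma monomial_value_factors: "monomial_value m = prod_list (map E (factors m))"
  by (induction m) (auto simp: monomial_value_def)

lemma pbw_monomials_Nil [simp]: "[] \<in> pbw_monomials"
  by (simp add: pbw_monomials_def)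

lemma pbw_monomials_Cons [simp]:
  "(u, t) # m \<in> pbw_monomials \<longleftrightarrow>
     lyndon u \<and> t \<ge> 1 \<and> (\<forall>v \<in> fst ` set m. v \<prec> u) \<and> m \<in> pbw_monomials"
  by (auto simp: pbw_monomials_def)

lemma set_factors: "m \<in> pbw_monomials \<Longrightarrow> set (factors m) = fst ` set m"
proof (induction m)
  case (Cons ut m)
  then show ?case
    by (cases ut) (simp add: set_replicate_conv_if)
qed simp

lemma lyndon_factors: "m \<in> pbw_monomials \<Longrightarrow> v \<in> set (factors m) \<Longrightarrow> lyndon v"
  by (induction m) (auto split: if_splits)

lemma sorted_factors:
  "m \<in> pbw_monomials \<Longrightarrow> sorted_wrt (\<lambda>u v. \<not> u \<prec> v) (factors m)"
proof (induction m)
  case (Cons ut m)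
  obtain u t where ut: "ut = (u, t)"
    by fastforce
  have "sorted_wrt (\<lambda>u v. \<not> u \<prec> v) (replicate t u)"
    by (induction t) auto
  then show ?case
    using Cons set_factors[of m] by (auto simp: ut sorted_wrt_append dest: word.less_asym)
qed auto

text \<open>A further factor in front either raises the first exponent or opens a new block with
  exponent 1.\<close>

lemma factors_exists:
  assumes "\<forall>v \<in> set l. lyndon v" "sorted_wrt (\<lambda>u v. \<not> u \<prec> v) l"
  shows "\<exists>m \<in> pbw_monomials. factors m = l"
  using assms
proof (induction l)
  case Nil
  show ?case
    by (intro bexI[of _ "[]"]) auto
next
  case (Cons u l)
  then obtain m where m: "m \<in> pbw_monomials" "factors m = l"
    by auto
  have le: "\<not> u \<prec> v" if "v \<in> fst ` set m" for v
    using Cons.prems(2) that set_factors[OF m(1)] m(2) by auto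
  show ?case
  proof (cases "m \<noteq> [] \<and> fst (hd m) = u")
    case True
    then obtain t m' where "m = (u, t) # m'"
      by (cases m) auto
    then show ?thesis
      using m by (intro bexI[of _ "(u, Suc t) # m'"]) auto
  next
    case False
    have "v \<prec> u" if v: "v \<in> fst ` set m" for v
    proof -
      obtain w s m' where m': "m = (w, s) # m'"
        using v by (cases m) auto
      then have "w \<prec> u"
        using False le[of w] word.linear[of w u] by fastforce
      moreover have "v = w \<or> v \<prec> w"
        using v m(1) m' by auto
      ultimately show ?thesis
        by (auto intro: word.less_trans)
    qed
    then show ?thesis
      using m Cons.prems(1) by (intro bexI[of _ "(u, 1) # m"]) auto
  qed
qed

lemma factors_inj:
  "m \<in> pbw_monomials \<Longrightarrow> m' \<in> pbw_monomials \<Longrightarrow> factors m = factors m' \<Longrightarrow> m = m'"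
proof (induction m arbitrary: m')
  case Nil
  then show ?case
    by (cases m') auto
next
  case (Cons ut m)
  obtain u t where ut: "ut = (u, t)"
    by fastforce
  obtain v s n where m': "m' = (v, s) # n"
    using Cons.prems ut by (cases m') auto
  have uv: "u = v"
    using Cons.prems ut m' by (cases t; cases s) auto
  \<comment> \<open>All later factors are strictly below \<open>u\<close>, so its exponent can be
    read off as a multiplicity.\<close>
  have notin: "u \<notin> set (factors m)" "u \<notin> set (factors n)"
    using Cons.prems ut m' uv by (auto simp: set_factors)
  then have "count_list (factors m) u = 0" "count_list (factors n) u = 0"
    by (simp_all add: count_list_0_iff)
  moreover have "count_list (replicate r u) u = r" for r
    by (induction r) auto
  ultimately have "t = s"
    using arg_cong[OF Cons.prems(3), of "\<lambda>l. count_list l u"] ut m' uv by simp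
  then show ?case
    using Cons ut m' uv by auto
qed

lemma monomial_value_leads:
  assumes "m \<in> pbw_monomials"
  shows "leads (monomial_value m) (concat (factors m))"
  using leads_prod_list[of "factors m" E "\<lambda>w. w"] lyndon_factors[OF assms] leads_E
  by (auto simp: monomial_value_factors)

lemma concat_factors_inj:
  assumes "m \<in> pbw_monomials" "m' \<in> pbw_monomials" "concat (factors m) = concat (factors m')"
  shows "m = m'"
  using assms by (intro factors_inj lyndon_factorization_unique) (auto intro: lyndon_factors sorted_factors)

lemma monomial_value_leads_inj:
  assumes "m \<in> pbw_monomials" "m' \<in> pbw_monomials" "leads (monomial_value m) w" "leads (monomial_value m') w"
  shows "m = m'"
  using assms leads_unique[OF monomial_value_leads] by (metis concat_factors_inj)

text \<open>Coefficients are attached to values in the algebra; injectivity permits indexing them by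
  monomials.\<close>

lemma monomial_value_inj: "inj_on (monomial_value :: monomial \<Rightarrow> 'k::field free_algebra) pbw_monomials"
  by (intro inj_onI monomial_value_leads_inj[where 'a = 'k]) (auto intro: monomial_value_leads)

lemma triangular_pbw_basis: "triangular pbw_basis"
  unfolding triangular_def pbw_basis_def
  using monomial_value_leads monomial_value_leads_inj by blast

lemma span_pbw_basis: "free_algebra.span pbw_basis = UNIV"
proof (rule span_eq_UNIV)
  fix w
  obtain l where l: "\<forall>v \<in> set l. lyndon v" "sorted_wrt (\<lambda>u v. \<not> u \<prec> v) l" "concat l = w"
    using lyndon_factorization_exists by blast
  then obtain m where "m \<in> pbw_monomials" "factors m = l"
    using factors_exists by blast
  then show "\<exists>b \<in> pbw_basis. leads b w"
    using l(3) monomial_value_leads by (auto simp: pbw_basis_def)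
qed

lemma pbw_part_in_span:
  "pbw_part P p \<in> free_algebra.span (monomial_value ` {m \<in> pbw_monomials. P m})"
  unfolding pbw_part_def
  by (intro free_algebra.span_sum free_algebra.span_scale free_algebra.span_base) auto

text \<open>Here the basis property enters: an independent and spanning \<open>pbw_basis\<close>
  makes \<open>representation\<close> the true expansion of \<open>p\<close>. Its finite sum is
  reindexed by monomials and split according to \<open>P\<close>.\<close>

lemma pbw_part_add_compl:
  fixes p :: "'k::field free_algebra"
  shows "pbw_part P p + pbw_part (\<lambda>m. \<not> P m) p = p"
proof -
  define R where "R = free_algebra.representation pbw_basis p"
  define A where "A = {m \<in> pbw_monomials. R (monomial_value m) \<noteq> 0}"
  have "b \<in> pbw_basis" if "R b \<noteq> 0" for b
    using that free_algebra.representation_ne_zero unfolding R_def by blast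
  then have image: "monomial_value ` A = {b. R b \<noteq> 0}"
    by (auto simp: A_def pbw_basis_def)
  have inj: "inj_on (monomial_value :: monomial \<Rightarrow> 'k free_algebra) A"
    using monomial_value_inj by (rule inj_on_subset) (auto simp: A_def)
  have "finite {b. R b \<noteq> 0}"
    unfolding R_def by (rule free_algebra.finite_representation)
  then have fin: "finite A"
    using finite_imageD[OF _ inj] unfolding image by blast
  have part: "pbw_part Q p = (\<Sum>m \<in> {m \<in> A. Q m}. scale (R (monomial_value m)) (monomial_value m))" for Q
    unfolding pbw_part_def by (intro sum.cong) (auto simp: pbw_coeff_def A_def R_def)
  have "p = (\<Sum>b | R b \<noteq> 0. scale (R b) b)"
    unfolding R_def
    by (intro free_algebra.sum_nonzero_representation_eq[symmetric])
      (auto simp: triangular_independent triangular_pbw_basis span_pbw_basis)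
  also have "\<dots> = (\<Sum>m \<in> A. scale (R (monomial_value m)) (monomial_value m))"
    unfolding image[symmetric] using inj by (simp add: sum.reindex)
  also have "\<dots> = pbw_part P p + pbw_part (\<lambda>m. \<not> P m) p"
    unfolding part by (subst sum.union_disjoint[symmetric]) (auto simp: fin intro: sum.cong)
  finally show ?thesis ..
qed

section \<open>Subalgebras stable under a derivation\<close>

lemma lookup_degree_component:
  "Poly_Mapping.lookup (degree_component a k p) w =
     (if count_list (letters w) a = k then Poly_Mapping.lookup p w else 0)"
  by (auto simp: degree_component_def lookup_sum lookup_single when_def in_keys_iff
      if_distrib cong: if_cong)

lemma degree_component_zero [simp]: "degree_component a k 0 = 0"
  by (simp add: degree_component_def)

lemma degree_component_add:
  "degree_component a k (p + q) = degree_component a k p + degree_component a k q"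
  by (rule poly_mapping_eqI) (simp add: lookup_degree_component lookup_add)

lemma degree_component_scale: "degree_component a k (scale c p) = scale c (degree_component a k p)"
  by (rule poly_mapping_eqI) (simp add: lookup_degree_component lookup_scale)

lemma degree_component_sum:
  "degree_component a k (\<Sum>i \<in> I. f i) = (\<Sum>i \<in> I. degree_component a k (f i))"
  by (induction I rule: infinite_finite_induct) (simp_all add: degree_component_add)

text \<open>All words of \<open>p\<close> have the same letters as \<open>w\<close>, so
  \<open>p\<close> is homogeneous in each letter.\<close>

lemma degree_component_leads:
  assumes "leads p w"
  shows "degree_component a k p = (if count_list w a = k then p else 0)"
proof -
  have "count_list (letters v) a = count_list w a" if "Poly_Mapping.lookup p v \<noteq> 0" for v
    using leads_lookup(2)[OF assms, of "letters v"] that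
    by (auto simp flip: count_mset)
  then show ?thesis
    by (intro poly_mapping_eqI) (force simp: lookup_degree_component)
qed

text \<open>The component operator is linear and maps each homogeneous generator to itself or to
  0.\<close>

lemma degree_component_span:
  assumes "\<And>b. b \<in> B \<Longrightarrow> \<exists>w. leads b w" "p \<in> free_algebra.span B"
  shows "degree_component a k p \<in> free_algebra.span B"
  using assms(2)
proof (induction rule: free_algebra.span_induct_alt)
  case base
  show ?case
    by (simp add: free_algebra.span_zero)
next
  case (step c b q)
  obtain w where "leads b w"
    using assms(1) step(1) by blast
  then have "degree_component a k b \<in> free_algebra.span B"
    using free_algebra.span_base[OF step(1)] free_algebra.span_zero[of B]
    by (simp add: degree_component_leads)
  with step(2) show ?case
    unfolding degree_component_add degree_component_scale
    by (intro free_algebra.span_add free_algebra.span_scale)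
qed

lemma keys_degree_component: "Poly_Mapping.keys (degree_component a k p) \<subseteq> Poly_Mapping.keys p"
  by (auto simp: in_keys_iff lookup_degree_component split: if_splits)

lemma subspace_keys: "free_algebra.subspace {p. Poly_Mapping.keys p \<subseteq> S}"
proof (rule free_algebra.subspaceI)
  fix p q :: "'a free_algebra" and c
  assume "p \<in> {p. Poly_Mapping.keys p \<subseteq> S}"
  then show "scale c p \<in> {p. Poly_Mapping.keys p \<subseteq> S}"
    by (auto simp: in_keys_iff lookup_scale)
  assume "q \<in> {p. Poly_Mapping.keys p \<subseteq> S}"
  then show "p + q \<in> {p. Poly_Mapping.keys p \<subseteq> S}"
    using \<open>p \<in> _\<close> keys_add[of p q] by blast
qed simp

lemma span_mult:
  assumes "\<And>p q. p \<in> S \<Longrightarrow> q \<in> S \<Longrightarrow> p * q \<in> S"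
    and "p \<in> free_algebra.span S" "q \<in> free_algebra.span S"
  shows "p * q \<in> free_algebra.span S"
  using assms(2)
proof (induction rule: free_algebra.span_induct_alt)
  case base
  show ?case
    by (simp add: free_algebra.span_zero)
next
  case (step c b p)
  have "b * q \<in> free_algebra.span S"
    using assms(3)
  proof (induction rule: free_algebra.span_induct_alt)
    case base
    show ?case
      by (simp add: free_algebra.span_zero)
  next
    case (step d b' q)
    then show ?case
      using assms(1) \<open>b \<in> S\<close>
      by (auto simp: distrib_left scale_mult_right
          intro!: free_algebra.span_add free_algebra.span_scale intro: free_algebra.span_base)
  qed
  with step show ?case
    by (auto simp: distrib_right scale_mult_left intro!: free_algebra.span_add free_algebra.span_scale)
qed

section \<open>Derivations and the algebra generated by iterates\<close>

definition derivation :: "('k::field free_algebra \<Rightarrow> 'k free_algebra) \<Rightarrow> bool" where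
  "derivation d \<longleftrightarrow> (\<forall>p q. d (p + q) = d p + d q) \<and> (\<forall>c p. d (scale c p) = scale c (d p)) \<and>
     (\<forall>p q. d (p * q) = d p * q + p * d q)"

lemma derivation_commutator_left: "derivation (commutator x)"
  by (simp add: derivation_def commutator_def algebra_simps scale_mult_left scale_mult_right
      free_algebra.scale_right_diff_distrib)

lemma derivation_commutator_right: "derivation (\<lambda>p. commutator p x)"
  by (simp add: derivation_def commutator_def algebra_simps scale_mult_left scale_mult_right
      free_algebra.scale_right_diff_distrib)

lemma derivation_zero: "derivation d \<Longrightarrow> d 0 = 0"
  unfolding derivation_def by (metis add_cancel_right_right add_0_right)

lemma derivation_one: "derivation d \<Longrightarrow> d 1 = 0"
  unfolding derivation_def by (metis add_cancel_right_right mult_1_right mult_1)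

definition iterate_prod ::
  "('k::field free_algebra \<Rightarrow> 'k free_algebra) \<Rightarrow> 'k free_algebra \<Rightarrow> nat list \<Rightarrow> 'k free_algebra" where
  "iterate_prod d y is = prod_list (map (\<lambda>i. (d ^^ i) y) is)"

text \<open>For a derivation \<open>d\<close> this is the smallest unital subalgebra that contains
  \<open>y\<close> and is stable under \<open>d\<close>. The explicit spanning set makes leading
  words computable.\<close>

definition derivation_closure ::
  "('k::field free_algebra \<Rightarrow> 'k free_algebra) \<Rightarrow> 'k free_algebra \<Rightarrow> 'k free_algebra set" where
  "derivation_closure d y = free_algebra.span (range (iterate_prod d y))"

lemma derivation_closure_mult: "p \<in> derivation_closure d y \<Longrightarrow> q \<in> derivation_closure d y \<Longrightarrow> p * q \<in> derivation_closure d y"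
  unfolding derivation_closure_def
proof (rule span_mult)
  fix p q assume "p \<in> range (iterate_prod d y)" "q \<in> range (iterate_prod d y)"
  then obtain i j where "p = iterate_prod d y i" "q = iterate_prod d y j"
    by blast
  then have "p * q = iterate_prod d y (i @ j)"
    by (simp add: iterate_prod_def)
  then show "p * q \<in> range (iterate_prod d y)"
    by simp
qed

lemma derivation_closure_add: "p \<in> derivation_closure d y \<Longrightarrow> q \<in> derivation_closure d y \<Longrightarrow> p + q \<in> derivation_closure d y"
  unfolding derivation_closure_def by (rule free_algebra.span_add)

lemma derivation_closure_diff: "p \<in> derivation_closure d y \<Longrightarrow> q \<in> derivation_closure d y \<Longrightarrow> p - q \<in> derivation_closure d y"
  unfolding derivation_closure_def by (rule free_algebra.span_diff)

lemma iterate_prod_in_closure: "iterate_prod d y is \<in> derivation_closure d y"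
  unfolding derivation_closure_def by (rule free_algebra.span_base) simp

lemma derivation_closure_one: "1 \<in> derivation_closure d y"
  using iterate_prod_in_closure[of d y "[]"] by (simp add: iterate_prod_def)

lemma derivation_closure_iterate: "(d ^^ i) y \<in> derivation_closure d y"
  using iterate_prod_in_closure[of d y "[i]"] by (simp add: iterate_prod_def)

lemma derivation_closure_generator: "y \<in> derivation_closure d y"
  using derivation_closure_iterate[of 0] by simp

lemma derivation_closure_prod_list: "(\<And>p. p \<in> set ps \<Longrightarrow> p \<in> derivation_closure d y) \<Longrightarrow> prod_list ps \<in> derivation_closure d y"
  by (induction ps) (auto intro: derivation_closure_one derivation_closure_mult)

text \<open>By the Leibniz rule \<open>d\<close> sends a product of iterates to a sum of such
  products, each with one exponent raised by one.\<close>

lemma derivation_closure_stable: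
  assumes "derivation d" "p \<in> derivation_closure d y"
  shows "d p \<in> derivation_closure d y"
proof -
  have prod: "d (iterate_prod d y is) \<in> derivation_closure d y" for "is"
  proof (induction "is")
    case Nil
    show ?case
      using assms(1) by (simp add: iterate_prod_def derivation_one derivation_closure_def free_algebra.span_zero)
  next
    case (Cons i "is")
    have "iterate_prod d y (i # is) = (d ^^ i) y * iterate_prod d y is"
      by (simp add: iterate_prod_def)
    then have "d (iterate_prod d y (i # is)) =
        (d ^^ Suc i) y * iterate_prod d y is + (d ^^ i) y * d (iterate_prod d y is)"
      using assms(1) by (simp add: derivation_def)
    also have "\<dots> \<in> derivation_closure d y"
      by (intro derivation_closure_add derivation_closure_mult derivation_closure_iterate iterate_prod_in_closure Cons.IH)
    finally show ?case .
  qed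
  from assms(2) show ?thesis
    unfolding derivation_closure_def
  proof (induction rule: free_algebra.span_induct_alt)
    case base
    show ?case
      using assms(1) by (simp add: derivation_zero free_algebra.span_zero)
  next
    case (step c b p)
    then show ?case
      using assms(1) prod
      by (auto simp: derivation_def derivation_closure_def intro!: free_algebra.span_add free_algebra.span_scale)
  qed
qed

text \<open>The recursion uses only \<open>commutator x\<close> and left multiplication by
  \<open>y\<close>, and both preserve the closure.\<close>

lemma bell_closure: "bell n x y \<in> derivation_closure (commutator x) y"
  by (induction n) (auto intro: derivation_closure_one derivation_closure_add derivation_closure_mult derivation_closure_generator
      derivation_closure_stable derivation_commutator_left)

lemma dual_bell_closure: "dual_bell n x y \<in> derivation_closure (\<lambda>p. commutator p x) y"
proof (induction n)
  case (Suc n)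
  then show ?case
    using derivation_closure_stable[OF derivation_commutator_right Suc]
    by (auto intro: derivation_closure_add derivation_closure_mult derivation_closure_generator)
qed (simp add: derivation_closure_one)

text \<open>The step rests on \<open>(x + y) * b = commutator x b + y * b + b * x\<close>, whose
  last term joins the remainder.\<close>

lemma power_eq_bell: "\<exists>q. (x + y) ^ n = bell n x y + q * x" for x y :: "'a::ring_1"
proof (induction n)
  case 0
  show ?case
    by (intro exI[of _ 0]) simp
next
  case (Suc n)
  then obtain q where "(x + y) ^ n = bell n x y + q * x"
    by blast
  then show ?case
    by (intro exI[of _ "bell n x y + (x + y) * q"]) (simp add: commutator_def algebra_simps)
qed

text \<open>Mirror image, with the new factor on the right:
  \<open>b * (x + y) = commutator b x + b * y + x * b\<close>. Hence the unfolding by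
  \<open>power_Suc2\<close>.\<close>

lemma power_eq_dual_bell: "\<exists>q. (x + y) ^ n = dual_bell n x y + x * q" for x y :: "'a::ring_1"
proof (induction n)
  case 0
  show ?case
    by (intro exI[of _ 0]) simp
next
  case (Suc n)
  then obtain q where "(x + y) ^ n = dual_bell n x y + x * q"
    by blast
  then show ?case
    by (intro exI[of _ "dual_bell n x y + q * (x + y)"])
      (simp add: power_Suc2 commutator_def algebra_simps del: power_Suc)
qed

lemma power_eq_sum_words:
  "(x + y) ^ n = (\<Sum>w | length w = n. prod_list (map (\<lambda>b. if b then y else x) w))"
  for x y :: "'a::ring_1"
proof (induction n)
  case 0
  show ?case
    by simp
next
  case (Suc n)
  let ?f = "\<lambda>w. prod_list (map (\<lambda>b. if b then y else x) w)"
  have "{w :: bool list. length w = Suc n} = (\<lambda>(b, w). b # w) ` (UNIV \<times> {w. length w = n})"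
    by (auto simp: length_Suc_conv image_iff)
  moreover have "inj_on (\<lambda>(b, w). b # w) (UNIV \<times> {w :: bool list. length w = n})"
    by (auto simp: inj_on_def)
  ultimately have "sum ?f {w. length w = Suc n} = (\<Sum>(b, w) \<in> UNIV \<times> {w. length w = n}. ?f (b # w))"
    by (simp add: sum.reindex case_prod_unfold)
  also have "\<dots> = (\<Sum>b \<in> UNIV. \<Sum>w | length w = n. ?f (b # w))"
    by (rule sum.cartesian_product[symmetric])
  also have "\<dots> = (x + y) * sum ?f {w. length w = n}"
    by (simp add: UNIV_bool distrib_right sum_distrib_left sum.distrib)
  finally show ?case
    using Suc by simp
qed

text \<open>Each product in the expansion of the power is homogeneous, so taking a component selects
  products by the count of one letter; the length \<open>i + j\<close> fixes the other count. The
  two versions serve the two parts of the theorem, which count different letters.\<close>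

lemma SH_E_eq_degree_component:
  defines "p \<equiv> E [L1] + E [L2] :: 'k::field free_algebra"
  shows "degree_component L2 i (p ^ (i + j)) = SH_E i j"
    and "degree_component L1 j (p ^ (i + j)) = SH_E i j"
proof -
  define enc where "enc = map (\<lambda>b. if b then L2 else L1)"
  let ?f = "\<lambda>w. prod_list (map (\<lambda>b. if b then E [L2] else E [L1] :: 'k free_algebra) w)"
  have "concat (map (\<lambda>b. if b then [L2] else [L1]) w) = enc w" for w
    by (induction w) (auto simp: enc_def)
  then have f: "leads (?f w) (enc w)" for w
    using leads_prod_list[of w "\<lambda>b. if b then E [L2] else E [L1] :: 'k free_algebra" "\<lambda>b. if b then [L2] else [L1]"]
    by (simp add: leads_E)
  have enc: "count_list (enc w) L2 = count_list w True" "count_list (enc w) L1 = count_list w False" for w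
    by (induction w) (auto simp: enc_def)
  have len: "count_list w True + count_list w False = length w" for w
    by (induction w) auto
  have fin: "finite {w :: bool list. length w = i + j}"
    using finite_lists_length_eq[of "UNIV :: bool set"] by simp
  have sets: "{w. length w = i + j \<and> count_list w True = i} = {w. count_list w True = i \<and> count_list w False = j}"
    "{w. length w = i + j \<and> count_list w False = j} = {w. count_list w True = i \<and> count_list w False = j}"
    by (auto simp flip: len)
  show "degree_component L2 i (p ^ (i + j)) = SH_E i j"
    unfolding p_def power_eq_sum_words SH_E_def SH_def degree_component_sum degree_component_leads[OF f] enc
    using fin by (simp add: sets flip: sum.inter_filter)
  show "degree_component L1 j (p ^ (i + j)) = SH_E i j"
    unfolding p_def power_eq_sum_words SH_E_def SH_def degree_component_sum degree_component_leads[OF f] enc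
    using fin by (simp add: sets flip: sum.inter_filter)
qed

section \<open>Comparison of the two parts\<close>

text \<open>Collects what the inductions on bracketings require. The left factor inherits the
  initial letter \<open>L1\<close> and the right factor the final letter \<open>L2\<close>, which
  excludes \<open>[L2]\<close> and \<open>[L1]\<close> respectively.\<close>

lemma lyndon_bracket:
  assumes "lyndon w" "length w > 1"
  shows "E w = (commutator (E (left_factor w)) (E (right_factor w)) :: 'k::field free_algebra)"
    and "lyndon (left_factor w)" "left_factor w \<noteq> [L2]" "length (left_factor w) < length w"
    and "lyndon (right_factor w)" "right_factor w \<noteq> [L1]" "length (right_factor w) < length w"
proof -
  let ?u = "left_factor w" and ?v = "right_factor w"
  show "E w = (commutator (E ?u) (E ?v) :: 'k free_algebra)"
    using assms by (subst E.simps) simp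
  have uv: "?u @ ?v = w"
    using assms(2) by (rule left_factor_append_right_factor)
  show u: "lyndon ?u" and v: "lyndon ?v"
    using assms lyndon_left_factor right_factor by blast+
  then have ne: "?u \<noteq> []" "?v \<noteq> []"
    by auto
  then have "hd ?u = hd w" "last ?v = last w"
    using hd_append2[of ?u ?v] last_appendR[of ?v ?u] unfolding uv by simp_all
  then show "?u \<noteq> [L2]" "?v \<noteq> [L1]"
    using lyndon_ends[OF assms] by auto
  have "length ?u + length ?v = length w"
    using arg_cong[OF uv, of length] unfolding length_append .
  then show "length ?u < length w" "length ?v < length w"
    using ne by (simp_all flip: length_greater_0_conv)
qed

text \<open>If the left factor is \<open>[L1]\<close>, the bracket is the derivation applied to the
  right factor; otherwise both factors lie in the closure, which is stable under
  commutators.\<close>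

lemma E_closure:
  assumes "lyndon w" "w \<noteq> [L1]"
  shows "(E w :: 'k::field free_algebra) \<in> derivation_closure (commutator (E [L1])) (E [L2])"
  using assms
proof (induction w rule: measure_induct_rule[of length])
  case (less w)
  show ?case
  proof (cases "length w > 1")
    case False
    then have "w = [L2]"
      using less.prems by (cases w; cases "hd w") auto
    then show ?thesis
      by (simp add: derivation_closure_generator)
  next
    case True
    let ?u = "left_factor w" and ?v = "right_factor w"
    note bracket = lyndon_bracket(1)[where 'k = 'k, OF less.prems(1) True] lyndon_bracket(2-)[OF less.prems(1) True]
    have v: "E ?v \<in> derivation_closure (commutator (E [L1])) (E [L2] :: 'k free_algebra)"
      using bracket by (intro less.IH) auto
    show ?thesis
    proof (cases "?u = [L1]")
      case True
      then show ?thesis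
        using bracket(1) derivation_closure_stable[OF derivation_commutator_left v] by simp
    next
      case False
      then have "E ?u \<in> derivation_closure (commutator (E [L1])) (E [L2] :: 'k free_algebra)"
        using bracket by (intro less.IH) auto
      with v show ?thesis
        unfolding bracket(1) commutator_def[of "E ?u"] by (intro derivation_closure_diff derivation_closure_mult)
    qed
  qed
qed

text \<open>Mirror image: the derivation now occurs when the right factor is \<open>[L2]\<close>,
  and the left factor is never \<open>[L2]\<close>.\<close>

lemma E_dual_closure:
  assumes "lyndon w" "w \<noteq> [L2]"
  shows "(E w :: 'k::field free_algebra) \<in> derivation_closure (\<lambda>p. commutator p (E [L2])) (E [L1])"
  using assms
proof (induction w rule: measure_induct_rule[of length])
  case (less w)
  show ?case
  proof (cases "length w > 1")
    case False
    then have "w = [L1]"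
      using less.prems by (cases w; cases "hd w") auto
    then show ?thesis
      by (simp add: derivation_closure_generator)
  next
    case True
    let ?u = "left_factor w" and ?v = "right_factor w"
    note bracket = lyndon_bracket(1)[where 'k = 'k, OF less.prems(1) True] lyndon_bracket(2-)[OF less.prems(1) True]
    have u: "E ?u \<in> derivation_closure (\<lambda>p. commutator p (E [L2])) (E [L1] :: 'k free_algebra)"
      using bracket by (intro less.IH) auto
    show ?thesis
    proof (cases "?v = [L2]")
      case True
      then show ?thesis
        using bracket(1) derivation_closure_stable[OF derivation_commutator_right u] by simp
    next
      case False
      then have "E ?v \<in> derivation_closure (\<lambda>p. commutator p (E [L2])) (E [L1] :: 'k free_algebra)"
        using bracket by (intro less.IH) auto
      with u show ?thesis
        unfolding bracket(1) commutator_def[of "E ?u"] by (intro derivation_closure_diff derivation_closure_mult)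
    qed
  qed
qed

text \<open>The factors decrease and \<open>[L1]\<close> is the least nonempty word, so it can occur
  only as the last factor.\<close>

lemma monomial_value_closure:
  assumes "m \<in> pbw_monomials" "\<not> rightmost_is [L1] m"
  shows "monomial_value m \<in> derivation_closure (commutator (E [L1])) (E [L2])"
  unfolding monomial_value_factors
proof (rule derivation_closure_prod_list)
  have "[L1] \<notin> set (factors m)"
  proof
    assume L1: "[L1] \<in> set (factors m)"
    then obtain m0 u t where m: "m = m0 @ [(u, t)]"
      by (cases m rule: rev_cases) auto
    then have "u \<noteq> [L1]"
      using assms(2) by (simp add: rightmost_is_def)
    then have "[L1] \<in> fst ` set m0"
      using L1 set_factors[OF assms(1)] m by auto
    then have "u \<prec> [L1]" "lyndon u"
      using assms(1) m by (auto simp: pbw_monomials_def sorted_wrt_append)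
    then show False
      using L1_le[of u] by (cases u) auto
  qed
  then show "p \<in> derivation_closure (commutator (E [L1])) (E [L2])" if "p \<in> set (map E (factors m))" for p
    using that lyndon_factors[OF assms(1)] by (auto intro!: E_closure)
qed

text \<open>\<open>[L2]\<close> is the greatest Lyndon word, since a longer one begins with
  \<open>L1\<close>. So it can occur only as the first factor.\<close>

lemma monomial_value_dual_closure:
  assumes "m \<in> pbw_monomials" "\<not> leftmost_is [L2] m"
  shows "monomial_value m \<in> derivation_closure (\<lambda>p. commutator p (E [L2])) (E [L1])"
  unfolding monomial_value_factors
proof (rule derivation_closure_prod_list)
  have "[L2] \<notin> set (factors m)"
  proof
    assume L2: "[L2] \<in> set (factors m)"
    then obtain m0 u t where m: "m = (u, t) # m0"
      by (cases m) auto
    then have "u \<noteq> [L2]"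
      using assms(2) by (simp add: leftmost_is_def)
    then have "[L2] \<in> fst ` set m0"
      using L2 set_factors[OF assms(1)] m by auto
    then have u: "[L2] \<prec> u" "lyndon u"
      using assms(1) m by auto
    then have "length u > 1" "hd u = L2"
      by (cases u; cases "hd u"; auto)+
    then show False
      using lyndon_ends(1)[OF u(2)] by simp
  qed
  then show "p \<in> derivation_closure (\<lambda>p. commutator p (E [L2])) (E [L1])" if "p \<in> set (map E (factors m))" for p
    using that lyndon_factors[OF assms(1)] by (auto intro!: E_dual_closure)
qed

section \<open>One-sided multiples of a letter\<close>

lemma keys_E_letter: "Poly_Mapping.keys (E [a] :: 'k::field free_algebra) = {Word [a]}"
  by (simp add: E_letter gen_def)

lemma keys_mult_letter: "Poly_Mapping.keys (q * E [a]) \<subseteq> {w. suffix [a] (letters w)}"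
  using keys_mult[of q "E [a]"] by (auto simp: keys_E_letter plus_word_def)

lemma keys_letter_mult: "Poly_Mapping.keys (E [a] * q) \<subseteq> {w. prefix [a] (letters w)}"
  using keys_mult[of "E [a]" q] by (auto simp: keys_E_letter plus_word_def)

lemma keys_monomial_value_rightmost:
  assumes "m \<in> pbw_monomials" "rightmost_is [a] m"
  shows "Poly_Mapping.keys (monomial_value m :: 'k::field free_algebra) \<subseteq> {w. suffix [a] (letters w)}"
proof -
  obtain m0 t where m: "m = m0 @ [([a], t)]"
    using assms(2) by (cases m rule: rev_cases) (auto simp: rightmost_is_def)
  then obtain s where "t = Suc s"
    using assms(1) by (cases t) (auto simp: pbw_monomials_def)
  then have "monomial_value m = (monomial_value m0 * E [a] ^ s) * (E [a] :: 'k free_algebra)"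
    by (simp add: m monomial_value_def power_Suc2 mult.assoc del: power_Suc)
  then show ?thesis
    using keys_mult_letter by simp
qed

lemma keys_monomial_value_leftmost:
  assumes "m \<in> pbw_monomials" "leftmost_is [a] m"
  shows "Poly_Mapping.keys (monomial_value m :: 'k::field free_algebra) \<subseteq> {w. prefix [a] (letters w)}"
proof -
  obtain m0 t where m: "m = ([a], t) # m0"
    using assms(2) by (cases m) (auto simp: leftmost_is_def)
  then obtain s where "t = Suc s"
    using assms(1) by (cases t) auto
  then have "monomial_value m = (E [a] :: 'k free_algebra) * (E [a] ^ s * monomial_value m0)"
    by (simp add: m monomial_value_def mult.assoc)
  then show ?thesis
    using keys_letter_mult by simp
qed

text \<open>After the common prefix \<open>replicate i L1\<close>, the letter \<open>L1\<close>
  meets \<open>L2\<close>, so the product with \<open>L1\<close> in front supplies the leading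
  word.\<close>

lemma leads_iterate_commutator:
  "leads ((commutator (E [L1]) ^^ i) (E [L2])) (replicate i L1 @ [L2])"
proof (induction i)
  case 0
  show ?case
    by (simp add: leads_E)
next
  case (Suc i)
  have "[L1] @ replicate i L1 @ [L2] \<prec> (replicate i L1 @ [L2]) @ [L1]"
    by (induction i) auto
  from leads_commutator[OF leads_E Suc this] show ?case
    by simp
qed

lemma leads_iterate_commutator_right:
  "leads (((\<lambda>p. commutator p (E [L2])) ^^ i) (E [L1])) (L1 # replicate i L2)"
proof (induction i)
  case 0
  show ?case
    by (simp add: leads_E)
next
  case (Suc i)
  have "(L1 # replicate i L2) @ [L2] \<prec> [L2] @ L1 # replicate i L2"
    by simp
  from leads_commutator[OF Suc leads_E this] show ?case
    by (simp add: replicate_append_same)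
qed

lemma triangular_range:
  assumes "\<And>i. leads (f i) (l i)" "inj l"
  shows "triangular (range f)"
  unfolding triangular_def using assms leads_unique by (metis (no_types, lifting) injD rangeE)

text \<open>Unique decodability of the code words \<open>c i\<close>. The second hypothesis looks at
  the whole remaining text because the words \<open>L1 # replicate i L2\<close> of the dual case are
  not a prefix code.\<close>

lemma inj_concat_map:
  assumes "\<And>i. c i \<noteq> []" "\<And>i j u v. c i @ concat (map c u) = c j @ concat (map c v) \<Longrightarrow> i = j"
  shows "inj (\<lambda>is. concat (map c is))"
proof (rule injI)
  fix u v assume "concat (map c u) = concat (map c v)"
  then show "u = v"
  proof (induction u arbitrary: v)
    case Nil
    then show ?case
      using assms(1) by (cases v) auto
  next
    case (Cons i u)
    then obtain j v' where v: "v = j # v'"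
      using assms(1) by (cases v) auto
    moreover from this have "i = j"
      using Cons.prems by (auto intro: assms(2))
    ultimately show ?case
      using Cons by auto
  qed
qed

lemma derivation_closure_commutator_triangular:
  "leads (iterate_prod (commutator (E [L1])) (E [L2]) is) (concat (map (\<lambda>i. replicate i L1 @ [L2]) is))"
  "triangular (range (iterate_prod (commutator (E [L1])) (E [L2])))"
proof -
  show leads: "leads (iterate_prod (commutator (E [L1])) (E [L2]) is)
      (concat (map (\<lambda>i. replicate i L1 @ [L2]) is))" for "is"
    unfolding iterate_prod_def by (rule leads_prod_list) (rule leads_iterate_commutator)
  have inj: "replicate i L1 @ L2 # x = replicate j L1 @ L2 # y \<Longrightarrow> i = j" for i j x y
  proof (induction i arbitrary: j)
    case 0
    then show ?case
      by (cases j) auto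
  next
    case (Suc i)
    then show ?case
      by (cases j) auto
  qed
  have "inj (\<lambda>is. concat (map (\<lambda>i. replicate i L1 @ [L2]) is))"
    by (rule inj_concat_map) (auto dest: inj)
  with leads show "triangular (range (iterate_prod (commutator (E [L1])) (E [L2])))"
    by (rule triangular_range)
qed

lemma derivation_closure_commutator_right_triangular:
  "leads (iterate_prod (\<lambda>p. commutator p (E [L2])) (E [L1]) is) (concat (map (\<lambda>i. L1 # replicate i L2) is))"
  "triangular (range (iterate_prod (\<lambda>p. commutator p (E [L2])) (E [L1])))"
proof -
  show leads: "leads (iterate_prod (\<lambda>p. commutator p (E [L2])) (E [L1]) is)
      (concat (map (\<lambda>i. L1 # replicate i L2) is))" for "is"
    unfolding iterate_prod_def by (rule leads_prod_list) (rule leads_iterate_commutator_right)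
  \<comment> \<open>The run of \<open>L2\<close> ends where the next code word starts with
    \<open>L1\<close>, or at the end of the text.\<close>
  have inj: "i = j" if "replicate i L2 @ concat (map (\<lambda>i. L1 # replicate i L2) u) =
      replicate j L2 @ concat (map (\<lambda>i. L1 # replicate i L2) v)" for i j u v
    using that
  proof (induction i arbitrary: j)
    case 0
    then show ?case
      by (cases j; cases u) auto
  next
    case (Suc i)
    then show ?case
      by (cases j; cases v) auto
  qed
  have "inj (\<lambda>is. concat (map (\<lambda>i. L1 # replicate i L2) is))"
    by (rule inj_concat_map) (auto dest: inj)
  with leads show "triangular (range (iterate_prod (\<lambda>p. commutator p (E [L2])) (E [L1])))"
    by (rule triangular_range)
qed

text \<open>The leading words of the spanning products are empty or end in \<open>L2\<close>, and a
  nonzero element of the closure would contain one of them.\<close>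

lemma derivation_closure_commutator_eq_zero:
  fixes p :: "'k::field free_algebra"
  assumes "p \<in> derivation_closure (commutator (E [L1])) (E [L2])" "Poly_Mapping.keys p \<subseteq> {w. suffix [L1] (letters w)}"
  shows "p = 0"
proof (rule ccontr)
  assume "p \<noteq> 0"
  then obtain "is" w where w: "leads (iterate_prod (commutator (E [L1])) (E [L2]) is :: 'k free_algebra) w"
    "Poly_Mapping.lookup p (Word w) \<noteq> 0"
    using triangular_span_nonzero[OF derivation_closure_commutator_triangular(2), of p] assms(1)
    unfolding derivation_closure_def by blast
  have "w = concat (map (\<lambda>i. replicate i L1 @ [L2]) is)"
    using leads_unique[OF w(1) derivation_closure_commutator_triangular(1)] .
  moreover have "suffix [L1] w"
    using assms(2) w(2) by (auto simp: in_keys_iff)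
  ultimately show False
    by (cases "is" rule: rev_cases) (auto simp: suffix_def)
qed

text \<open>Here the leading words of the spanning products are empty or begin with
  \<open>L1\<close>.\<close>

lemma derivation_closure_commutator_right_eq_zero:
  fixes p :: "'k::field free_algebra"
  assumes "p \<in> derivation_closure (\<lambda>p. commutator p (E [L2])) (E [L1])" "Poly_Mapping.keys p \<subseteq> {w. prefix [L2] (letters w)}"
  shows "p = 0"
proof (rule ccontr)
  assume "p \<noteq> 0"
  then obtain "is" w where w: "leads (iterate_prod (\<lambda>p. commutator p (E [L2])) (E [L1]) is :: 'k free_algebra) w"
    "Poly_Mapping.lookup p (Word w) \<noteq> 0"
    using triangular_span_nonzero[OF derivation_closure_commutator_right_triangular(2), of p] assms(1)
    unfolding derivation_closure_def by blast
  have "w = concat (map (\<lambda>i. L1 # replicate i L2) is)"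
    using leads_unique[OF w(1) derivation_closure_commutator_right_triangular(1)] .
  moreover have "prefix [L2] w"
    using assms(2) w(2) by (auto simp: in_keys_iff)
  ultimately show False
    by (cases "is") auto
qed

lemma pbw_part_closure:
  assumes "\<And>m. m \<in> pbw_monomials \<Longrightarrow> P m \<Longrightarrow> monomial_value m \<in> derivation_closure d y"
  shows "pbw_part P p \<in> derivation_closure d y"
proof -
  have "free_algebra.span (monomial_value ` {m \<in> pbw_monomials. P m}) \<subseteq> derivation_closure d y"
    using assms by (intro free_algebra.span_minimal) (auto simp: derivation_closure_def)
  then show ?thesis
    using pbw_part_in_span by blast
qed

lemma keys_pbw_part:
  assumes "\<And>m. m \<in> pbw_monomials \<Longrightarrow> P m \<Longrightarrow> Poly_Mapping.keys (monomial_value m :: 'k free_algebra) \<subseteq> S"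
  shows "Poly_Mapping.keys (pbw_part P (p :: 'k::field free_algebra)) \<subseteq> S"
proof -
  have "free_algebra.span (monomial_value ` {m \<in> pbw_monomials. P m}) \<subseteq>
      {p :: 'k free_algebra. Poly_Mapping.keys p \<subseteq> S}"
    using assms by (intro free_algebra.span_minimal subspace_keys) auto
  then show ?thesis
    using pbw_part_in_span by blast
qed

lemma bell_component_eq_SH_2:
  assumes "k \<le> n"
  shows "(bell_component n k L1 L2 :: 'k::field free_algebra) = SH_2 k (n - k)"
proof -
  let ?x = "E [L1] :: 'k free_algebra" and ?y = "E [L2] :: 'k free_algebra"
  let ?P = "\<lambda>m. \<not> rightmost_is [L1] m" and ?S = "SH_E k (n - k) :: 'k free_algebra"
  obtain q where q: "(?x + ?y) ^ n = bell n ?x ?y + q * ?x"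
    using power_eq_bell by blast
  \<comment> \<open>The bound \<open>k \<le> n\<close> gives \<open>k + (n - k) = n\<close> for the
    truncated subtraction.\<close>
  have "?S = degree_component L2 k ((?x + ?y) ^ n)"
    using SH_E_eq_degree_component(1)[where 'k = 'k, of k "n - k"] assms by simp
  then have "?S = bell_component n k L1 L2 + degree_component L2 k (q * ?x)"
    by (simp add: q degree_component_add bell_component_def)
  moreover have "?S = SH_2 k (n - k) + pbw_part (\<lambda>m. \<not> ?P m) ?S"
    by (simp only: SH_2_def pbw_part_add_compl)
  \<comment> \<open>The left side will be placed in the derivation closure, while the right side has
    only words ending in \<open>L1\<close>.\<close>
  ultimately have diff: "bell_component n k L1 L2 - SH_2 k (n - k) =
      pbw_part (\<lambda>m. \<not> ?P m) ?S - degree_component L2 k (q * ?x)"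
    by (simp add: algebra_simps)
  \<comment> \<open>The closure is spanned by homogeneous products, so passing to the component of
    degree \<open>k\<close> does not leave it.\<close>
  have "bell_component n k L1 L2 \<in> derivation_closure (commutator ?x) ?y"
    using bell_closure[of n ?x ?y] derivation_closure_commutator_triangular(1)
    unfolding bell_component_def derivation_closure_def by (intro degree_component_span) auto
  moreover have "SH_2 k (n - k) \<in> derivation_closure (commutator ?x) ?y"
    unfolding SH_2_def by (rule pbw_part_closure) (rule monomial_value_closure)
  ultimately have "bell_component n k L1 L2 - SH_2 k (n - k) \<in> derivation_closure (commutator ?x) ?y"
    by (rule derivation_closure_diff)
  moreover have "Poly_Mapping.keys (pbw_part (\<lambda>m. \<not> ?P m) ?S) \<subseteq> {w. suffix [L1] (letters w)}"
    by (rule keys_pbw_part) (simp add: keys_monomial_value_rightmost)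
  then have "Poly_Mapping.keys (bell_component n k L1 L2 - SH_2 k (n - k) :: 'k free_algebra)
      \<subseteq> {w. suffix [L1] (letters w)}"
    unfolding diff using subset_trans[OF keys_degree_component keys_mult_letter]
    by (intro subset_trans[OF keys_minus_subset] Un_least)
  ultimately have "(bell_component n k L1 L2 - SH_2 k (n - k) :: 'k free_algebra) = 0"
    by (rule derivation_closure_commutator_eq_zero)
  then show ?thesis
    by simp
qed

lemma dual_bell_component_eq_SH':
  assumes "k \<le> n"
  shows "(dual_bell_component n k L2 L1 :: 'k::field free_algebra) = SH' (n - k) k"
proof -
  \<comment> \<open>The letters exchange roles: \<open>k\<close> now counts \<open>L1\<close>, so
    \<open>n - k\<close> counts \<open>L2\<close> and is the first index of the shuffle sum.\<close>
  let ?x = "E [L2] :: 'k free_algebra" and ?y = "E [L1] :: 'k free_algebra"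
  let ?P = "\<lambda>m. \<not> leftmost_is [L2] m" and ?S = "SH_E (n - k) k :: 'k free_algebra"
  obtain q where q: "(?x + ?y) ^ n = dual_bell n ?x ?y + ?x * q"
    using power_eq_dual_bell by blast
  have "?S = degree_component L1 k ((?x + ?y) ^ n)"
    using SH_E_eq_degree_component(2)[where 'k = 'k, of k "n - k"] assms by (simp add: add.commute)
  then have "?S = dual_bell_component n k L2 L1 + degree_component L1 k (?x * q)"
    by (simp add: q degree_component_add dual_bell_component_def)
  moreover have "?S = SH' (n - k) k + pbw_part (\<lambda>m. \<not> ?P m) ?S"
    by (simp only: SH'_def pbw_part_add_compl)
  ultimately have diff: "dual_bell_component n k L2 L1 - SH' (n - k) k =
      pbw_part (\<lambda>m. \<not> ?P m) ?S - degree_component L1 k (?x * q)"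
    by (simp add: algebra_simps)
  have "dual_bell_component n k L2 L1 \<in> derivation_closure (\<lambda>p. commutator p ?x) ?y"
    using dual_bell_closure[of n ?x ?y] derivation_closure_commutator_right_triangular(1)
    unfolding dual_bell_component_def derivation_closure_def by (intro degree_component_span) auto
  moreover have "SH' (n - k) k \<in> derivation_closure (\<lambda>p. commutator p ?x) ?y"
    unfolding SH'_def by (rule pbw_part_closure) (rule monomial_value_dual_closure)
  ultimately have "dual_bell_component n k L2 L1 - SH' (n - k) k \<in> derivation_closure (\<lambda>p. commutator p ?x) ?y"
    by (rule derivation_closure_diff)
  moreover have "Poly_Mapping.keys (pbw_part (\<lambda>m. \<not> ?P m) ?S) \<subseteq> {w. prefix [L2] (letters w)}"
    by (rule keys_pbw_part) (simp add: keys_monomial_value_leftmost)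
  then have "Poly_Mapping.keys (dual_bell_component n k L2 L1 - SH' (n - k) k :: 'k free_algebra)
      \<subseteq> {w. prefix [L2] (letters w)}"
    unfolding diff using subset_trans[OF keys_degree_component keys_letter_mult]
    by (intro subset_trans[OF keys_minus_subset] Un_least)
  ultimately have "(dual_bell_component n k L2 L1 - SH' (n - k) k :: 'k free_algebra) = 0"
    by (rule derivation_closure_commutator_right_eq_zero)
  then show ?thesis
    by simp
qed

theorem theoremC:
  fixes n k :: nat
  assumes "k \<le> n"
  shows "(bell_component n k L1 L2 :: 'k::field free_algebra) = SH_2 k (n - k) \<and>
         (dual_bell_component n k L2 L1 :: 'k free_algebra) = SH' (n - k) k"
  using assms by (simp add: bell_component_eq_SH_2 dual_bell_component_eq_SH')

end
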